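(* Let $X$ and $Y$ be extended metric spaces, let $\mathcal H_X$ and $\mathcal H_Y$ be faithful discrete modules over $X$ and $Y$ respectively, and let $U\colon\mathcal H_X\to\mathcal H_Y$ be a unitary such that both ${\rm Ad}(U)\colon\mathcal B(\mathcal H_X)\to\mathcal B(\mathcal H_Y)$ and ${\rm Ad}(U^* )\colon\mathcal B(\mathcal H_Y)\to\mathcal B(\mathcal H_X)$ are quasi-controlled. Then, for every $0<\delta<1$ there are $r,R\ge 0$ large enough such that $f^U_{\delta,R,r}\colon X\to Y$ is a coarse equivalence with coarse inverse $f^{U^*}_{\delta,r,R}$.
   Context: An extended metric space is a set with a metric allowed to take the value $+\infty$. A subset $D\subseteq X$ is coarsely dense if there is $R<\infty$ such that every point of $X$ is within distance $R$ of $D$. An $X$-module is a Hilbert space $\mathcal H_X$ with a unital Boolean algebra $\mathfrak A$ of subsets of $X$ (the measurable sets) and a map $A\mapsto 1_A$ from $\mathfrak A$ to projections in $\mathcal B(\mathcal H_X)$ with $1_{A\cap A'}=1_A1_{A'}$, $1_{A\sqcup A'}=1_A+1_{A'}$ for disjoint $A,A'$, $1_X=\mathrm{id}$, and such that for some $r\geq 0$ the subspaces $1_A(\mathcal H_X)$, with $A$ measurable of diameter $\le r$, span a dense subspace. It is discrete if there are $r\ge0$ and a partition $X=\bigsqcup_i A_i$ into measurable sets of diameter $\le r$ with $\sum_i 1_{A_i}=1$ strongly and such that $C\subseteq X$ is measurable whenever every $C\cap A_i$ is. It is faithful if for some $r\ge 0$ the union of the measurable sets $A$ of diameter $\le r$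 with $1_A\neq0$ is coarsely dense in $X$. An operator $t\in\mathcal B(\mathcal H_X)$ has propagation at most $r$ if $1_{A'}t1_A=0$ for all measurable $A,A'$ with $d(a',a)>r$ for all $a\in A$, $a'\in A'$. A map $\phi\colon\mathcal B(\mathcal H_X)\to\mathcal B(\mathcal H_Y)$ is quasi-controlled if for every $r\ge0$ and $\varepsilon>0$ there is $R\ge0$ such that for every $t$ of propagation at most $r$ one has $\|1_{B'}\phi(t)1_B\|\le\varepsilon\|t\|$ for all measurable $B,B'\subseteq Y$ with $d(b',b)>R$ for all $b\in B$, $b'\in B'$. ${\rm Ad}(U)(t)=UtU^*$. For a bounded operator $T\colon\mathcal H_X\to\mathcal H_Y$, $\delta>0$ and $r,R\ge0$, put \[ f^T_{\delta,R,r}=\bigcup\{B\times A\mid B\subseteq Y,\ A\subseteq X\text{ measurable},\ {\rm diam}(B)\le R,\ {\rm diam}(A)\le r,\ \|1_BT1_A\|>\delta\}\subseteq Y\times X . \] A relation $S\subseteq Y\times X$ is controlled if for every $r\ge0$ there is $R\ge0$ such that $(y,x),(y',x')\in S$ and $d(x,x')\le r$ imply $d(y,y')\le R$. If moreover its projection to $X$ is coarsely dense, $S$ defines a coarse map $X\to Y$: there is a function $f\colon X\to Y$, unique up to uniformly bounded distance, that is controlled (for every $r$ there is $R$ with $d(x,x')\le r\Rightarrow d(f(x),f(x'))\le R$) and whose graph is at finite Hausdorff distance from $S$ in $Y\times X$. $S\subseteq Y\times X$ is a coarse equivalence with coarse inverse $S'\subseteq X\times Y$ if both define coarse maps in this sense,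 represented by functions $f$ and $f'$ with $f'\circ f$ and $f\circ f'$ at uniformly bounded distance from the identities. *)

theory Defs
  imports "HOL-Analysis.Analysis"
begin

section \<open>Complex Hilbert spaces\<close>

text \<open>The inner product is conjugate-linear in its first argument. The norm and the metric are
  those of \<^class>\<open>real_inner\<close>, which \<open>inner_eq_Re_cinner\<close> ties to the complex inner product.\<close>

class complex_hilbert = real_inner + banach +
  fixes scaleC :: "complex \<Rightarrow> 'a \<Rightarrow> 'a"
    and cinner :: "'a \<Rightarrow> 'a \<Rightarrow> complex"
  assumes scaleC_add_right: "scaleC c (x + y) = scaleC c x + scaleC c y"
    and scaleC_add_left: "scaleC (c + c') x = scaleC c x + scaleC c' x"
    and scaleC_scaleC: "scaleC c (scaleC c' x) = scaleC (c * c') x"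
    and scaleC_of_real: "scaleC (of_real a) x = a *\<^sub>R x"
    and cinner_commute: "cinner x y = cnj (cinner y x)"
    and cinner_add_left: "cinner (x + y) z = cinner x z + cinner y z"
    and cinner_scaleC_left: "cinner (scaleC c x) y = cnj c * cinner x y"
    and inner_eq_Re_cinner: "inner x y = Re (cinner x y)"

lemma vector_space_scaleC: "vector_space (scaleC :: complex \<Rightarrow> 'h \<Rightarrow> 'h::complex_hilbert)"
proof
  show "scaleC 1 x = x" for x :: 'h
    using scaleC_of_real[of 1 x] by simp
qed (simp_all add: scaleC_add_right scaleC_add_left scaleC_scaleC)

instantiation complex :: complex_hilbert
begin

definition scaleC_complex :: "complex \<Rightarrow> complex \<Rightarrow> complex" where
  "scaleC_complex c z = c * z"

definition cinner_complex :: "complex \<Rightarrow> complex \<Rightarrow> complex" where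
  "cinner_complex z w = cnj z * w"

instance
  by standard
    (auto simp: scaleC_complex_def cinner_complex_def algebra_simps inner_complex_def scaleR_conv_of_real)

end

abbreviation cspan :: "'h::complex_hilbert set \<Rightarrow> 'h set" where
  "cspan \<equiv> module.span scaleC"

section \<open>Bounded operators\<close>

text \<open>Bounded complex-linear operators are the bounded real-linear maps (type \<open>\<Rightarrow>\<^sub>L\<close>) that commute
  with complex scalars; the operator norm is the norm of \<open>\<Rightarrow>\<^sub>L\<close>.\<close>

definition bounded_ops :: "('h::complex_hilbert \<Rightarrow>\<^sub>L 'k::complex_hilbert) set" where
  "bounded_ops = {T. \<forall>c x. blinfun_apply T (scaleC c x) = scaleC c (blinfun_apply T x)}"

definition is_adjoint ::
    "('h::complex_hilbert \<Rightarrow>\<^sub>L 'k::complex_hilbert) \<Rightarrow> ('k \<Rightarrow>\<^sub>L 'h) \<Rightarrow> bool" where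
  "is_adjoint T S \<longleftrightarrow> (\<forall>x y. cinner (blinfun_apply T x) y = cinner x (blinfun_apply S y))"

definition cadjoint ::
    "('h::complex_hilbert \<Rightarrow>\<^sub>L 'k::complex_hilbert) \<Rightarrow> ('k \<Rightarrow>\<^sub>L 'h)" where
  "cadjoint T = (THE S. is_adjoint T S)"

definition projection_op :: "('h::complex_hilbert \<Rightarrow>\<^sub>L 'h) \<Rightarrow> bool" where
  "projection_op p \<longleftrightarrow> p \<in> bounded_ops \<and> p o\<^sub>L p = p \<and> is_adjoint p p"

definition unitary_op :: "('h::complex_hilbert \<Rightarrow>\<^sub>L 'k::complex_hilbert) \<Rightarrow> bool" where
  "unitary_op U \<longleftrightarrow> U \<in> bounded_ops \<and> surj (blinfun_apply U) \<and>
     (\<forall>x y. cinner (blinfun_apply U x) (blinfun_apply U y) = cinner x y)"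

definition Ad :: "('h::complex_hilbert \<Rightarrow>\<^sub>L 'k::complex_hilbert) \<Rightarrow> ('h \<Rightarrow>\<^sub>L 'h) \<Rightarrow> ('k \<Rightarrow>\<^sub>L 'k)" where
  "Ad U t = U o\<^sub>L t o\<^sub>L cadjoint U"

lemma cadjoint_eqI:
  assumes "is_adjoint T S"
  shows "cadjoint T = S"
  unfolding cadjoint_def
proof (rule the_equality)
  show "is_adjoint T S" by (rule assms)
  fix S' assume S': "is_adjoint T S'"
  show "S' = S"
  proof (rule blinfun_eqI)
    fix y
    have "inner x (blinfun_apply S' y) = inner x (blinfun_apply S y)" for x
      using S' assms by (simp add: is_adjoint_def inner_eq_Re_cinner)
    then show "blinfun_apply S' y = blinfun_apply S y"
      by (metis inner_commute vector_eq_rdot)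
  qed
qed

text \<open>For a unitary the adjoint exists, so the definite description in \<open>cadjoint\<close> is harmless.\<close>

lemma unitary_op_cadjoint:
  fixes U :: "'h::complex_hilbert \<Rightarrow>\<^sub>L 'k::complex_hilbert"
  assumes "unitary_op U"
  shows "is_adjoint U (cadjoint U)" "cadjoint U o\<^sub>L U = id_blinfun" "U o\<^sub>L cadjoint U = id_blinfun"
proof -
  have iso: "cinner (U x) (U y) = cinner x y" for x y
    using assms by (simp add: unitary_op_def)
  have nrm: "norm (U x) = norm x" for x
    by (simp add: norm_eq_sqrt_inner inner_eq_Re_cinner iso)
  have inj: "inj (blinfun_apply U)"
  proof (rule injI)
    fix x y assume "U x = U y"
    then have "norm (U (x - y)) = 0" by (simp add: blinfun.diff_right)
    then show "x = y" by (simp add: nrm)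
  qed
  have bij: "bij (blinfun_apply U)"
    using assms inj by (simp add: bij_def unitary_op_def)
  let ?V = "inv (blinfun_apply U)"
  have UV: "U (?V y) = y" for y by (rule surj_f_inv_f[OF bij_is_surj[OF bij]])
  have VU: "?V (U x) = x" for x by (rule inv_f_f[OF inj])
  have bl: "bounded_linear ?V"
  proof (rule bounded_linear_intro)
    show "?V (x + y) = ?V x + ?V y" for x y
      by (metis UV VU blinfun.add_right)
    show "?V (r *\<^sub>R x) = r *\<^sub>R ?V x" for r x
      by (metis UV VU blinfun.scaleR_right)
    show "norm (?V x) \<le> norm x * 1" for x
      by (metis UV nrm mult.right_neutral order_refl)
  qed
  define S where "S = Blinfun ?V"
  have S: "blinfun_apply S = ?V"
    unfolding S_def by (rule bounded_linear_Blinfun_apply[OF bl])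
  have adj: "is_adjoint U S"
    unfolding is_adjoint_def S by (metis UV iso)
  then have eq: "cadjoint U = S" by (rule cadjoint_eqI)
  show "is_adjoint U (cadjoint U)" using adj eq by simp
  show "cadjoint U o\<^sub>L U = id_blinfun"
    unfolding eq by (rule blinfun_eqI) (simp add: S VU)
  show "U o\<^sub>L cadjoint U = id_blinfun"
    unfolding eq by (rule blinfun_eqI) (simp add: S UV)
qed

section \<open>Extended metric spaces\<close>

locale extended_metric =
  fixes X :: "'x set" and d :: "'x \<Rightarrow> 'x \<Rightarrow> ennreal"
  assumes dist_eq_0_iff: "x \<in> X \<Longrightarrow> y \<in> X \<Longrightarrow> d x y = 0 \<longleftrightarrow> x = y"
    and dist_sym: "x \<in> X \<Longrightarrow> y \<in> X \<Longrightarrow> d x y = d y x"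
    and dist_triangle: "x \<in> X \<Longrightarrow> y \<in> X \<Longrightarrow> z \<in> X \<Longrightarrow> d x z \<le> d x y + d y z"

text \<open>The supremum of the empty set in \<^typ>\<open>ennreal\<close> is \<open>0\<close>, so the empty set has diameter \<open>0\<close>.\<close>

definition ediam :: "('x \<Rightarrow> 'x \<Rightarrow> ennreal) \<Rightarrow> 'x set \<Rightarrow> ennreal" where
  "ediam d A = (SUP a\<in>A. SUP a'\<in>A. d a a')"

definition separated_by :: "('x \<Rightarrow> 'x \<Rightarrow> ennreal) \<Rightarrow> real \<Rightarrow> 'x set \<Rightarrow> 'x set \<Rightarrow> bool" where
  "separated_by d r A' A \<longleftrightarrow> (\<forall>a'\<in>A'. \<forall>a\<in>A. d a' a > ennreal r)"

definition coarsely_dense :: "'x set \<Rightarrow> ('x \<Rightarrow> 'x \<Rightarrow> ennreal) \<Rightarrow> 'x set \<Rightarrow> bool" where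
  "coarsely_dense X d D \<longleftrightarrow> D \<subseteq> X \<and> (\<exists>R\<ge>0. \<forall>x\<in>X. \<exists>y\<in>D. d x y \<le> ennreal R)"

text \<open>The maximum metric on a product; the sum metric gives the same sets at finite Hausdorff distance.\<close>

definition prod_edist ::
    "('y \<Rightarrow> 'y \<Rightarrow> ennreal) \<Rightarrow> ('x \<Rightarrow> 'x \<Rightarrow> ennreal) \<Rightarrow> 'y \<times> 'x \<Rightarrow> 'y \<times> 'x \<Rightarrow> ennreal" where
  "prod_edist dY dX p q = max (dY (fst p) (fst q)) (dX (snd p) (snd q))"

definition hausdorff_edist :: "('x \<Rightarrow> 'x \<Rightarrow> ennreal) \<Rightarrow> 'x set \<Rightarrow> 'x set \<Rightarrow> ennreal" where
  "hausdorff_edist d S T = max (SUP s\<in>S. INF t\<in>T. d s t) (SUP t\<in>T. INF s\<in>S. d s t)"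

section \<open>Modules over extended metric spaces\<close>

locale coarse_module = extended_metric X d + algebra X M
  for X :: "'x set" and d :: "'x \<Rightarrow> 'x \<Rightarrow> ennreal" and M :: "'x set set" +
  fixes P :: "'x set \<Rightarrow> ('h::complex_hilbert \<Rightarrow>\<^sub>L 'h)"
  assumes projection: "A \<in> M \<Longrightarrow> projection_op (P A)"
    and P_Int: "A \<in> M \<Longrightarrow> A' \<in> M \<Longrightarrow> P (A \<inter> A') = P A o\<^sub>L P A'"
    and P_disjoint_Un: "A \<in> M \<Longrightarrow> A' \<in> M \<Longrightarrow> A \<inter> A' = {} \<Longrightarrow> P (A \<union> A') = P A + P A'"
    and P_space: "P X = id_blinfun"
    and P_dense: "\<exists>r\<ge>0. closure (cspan (\<Union>A\<in>{A \<in> M. ediam d A \<le> ennreal r}. range (blinfun_apply (P A)))) = UNIV"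

locale discrete_module = coarse_module X d M P
  for X :: "'x set" and d and M and P :: "'x set \<Rightarrow> ('h::complex_hilbert \<Rightarrow>\<^sub>L 'h)" +
  assumes discrete: "\<exists>r\<ge>0. \<exists>\<A>. partition_on X \<A> \<and> \<A> \<subseteq> M \<and> (\<forall>A\<in>\<A>. ediam d A \<le> ennreal r) \<and>
    (\<forall>v. ((\<lambda>A. blinfun_apply (P A) v) has_sum v) \<A>) \<and>
    (\<forall>C\<subseteq>X. (\<forall>A\<in>\<A>. C \<inter> A \<in> M) \<longrightarrow> C \<in> M)"

locale faithful_module = coarse_module X d M P
  for X :: "'x set" and d and M and P :: "'x set \<Rightarrow> ('h::complex_hilbert \<Rightarrow>\<^sub>L 'h)" +
  assumes faithful: "\<exists>r\<ge>0. coarsely_dense X d (\<Union>{A \<in> M. ediam d A \<le> ennreal r \<and> P A \<noteq> 0})"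

definition propagation_le ::
    "('x \<Rightarrow> 'x \<Rightarrow> ennreal) \<Rightarrow> 'x set set \<Rightarrow> ('x set \<Rightarrow> ('h::complex_hilbert \<Rightarrow>\<^sub>L 'h)) \<Rightarrow>
     ('h \<Rightarrow>\<^sub>L 'h) \<Rightarrow> real \<Rightarrow> bool" where
  "propagation_le d M P t r \<longleftrightarrow>
     (\<forall>A\<in>M. \<forall>A'\<in>M. separated_by d r A' A \<longrightarrow> P A' o\<^sub>L t o\<^sub>L P A = 0)"

definition quasi_controlled ::
    "('x \<Rightarrow> 'x \<Rightarrow> ennreal) \<Rightarrow> 'x set set \<Rightarrow> ('x set \<Rightarrow> ('h::complex_hilbert \<Rightarrow>\<^sub>L 'h)) \<Rightarrow>
     ('y \<Rightarrow> 'y \<Rightarrow> ennreal) \<Rightarrow> 'y set set \<Rightarrow> ('y set \<Rightarrow> ('k::complex_hilbert \<Rightarrow>\<^sub>L 'k)) \<Rightarrow>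
     (('h \<Rightarrow>\<^sub>L 'h) \<Rightarrow> ('k \<Rightarrow>\<^sub>L 'k)) \<Rightarrow> bool" where
  "quasi_controlled dX MX PX dY MY PY \<phi> \<longleftrightarrow>
     (\<forall>r\<ge>0. \<forall>\<epsilon>>0. \<exists>R\<ge>0. \<forall>t\<in>bounded_ops. propagation_le dX MX PX t r \<longrightarrow>
       (\<forall>B\<in>MY. \<forall>B'\<in>MY. separated_by dY R B' B \<longrightarrow> norm (PY B' o\<^sub>L \<phi> t o\<^sub>L PY B) \<le> \<epsilon> * norm t))"

text \<open>\<open>approx_rel dX MX PX dY MY PY T \<delta> R r\<close> is a relation from \<open>X\<close> to \<open>Y\<close>, as a subset of \<open>Y \<times> X\<close>:
  \<open>R\<close> bounds diameters in the target \<open>Y\<close> and \<open>r\<close> diameters in the source \<open>X\<close>.\<close>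

definition approx_rel ::
    "('x \<Rightarrow> 'x \<Rightarrow> ennreal) \<Rightarrow> 'x set set \<Rightarrow> ('x set \<Rightarrow> ('h::complex_hilbert \<Rightarrow>\<^sub>L 'h)) \<Rightarrow>
     ('y \<Rightarrow> 'y \<Rightarrow> ennreal) \<Rightarrow> 'y set set \<Rightarrow> ('y set \<Rightarrow> ('k::complex_hilbert \<Rightarrow>\<^sub>L 'k)) \<Rightarrow>
     ('h \<Rightarrow>\<^sub>L 'k) \<Rightarrow> real \<Rightarrow> real \<Rightarrow> real \<Rightarrow> ('y \<times> 'x) set" where
  "approx_rel dX MX PX dY MY PY T \<delta> R r =
     \<Union>{B \<times> A | B A. B \<in> MY \<and> A \<in> MX \<and> ediam dY B \<le> ennreal R \<and> ediam dX A \<le> ennreal r \<and>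
        norm (PY B o\<^sub>L T o\<^sub>L PX A) > \<delta>}"

section \<open>Coarse maps and coarse equivalences\<close>

definition controlled_rel ::
    "('x \<Rightarrow> 'x \<Rightarrow> ennreal) \<Rightarrow> ('y \<Rightarrow> 'y \<Rightarrow> ennreal) \<Rightarrow> ('y \<times> 'x) set \<Rightarrow> bool" where
  "controlled_rel dX dY S \<longleftrightarrow>
     (\<forall>r\<ge>0. \<exists>R\<ge>0. \<forall>(y, x)\<in>S. \<forall>(y', x')\<in>S. dX x x' \<le> ennreal r \<longrightarrow> dY y y' \<le> ennreal R)"

definition controlled_fun ::
    "'x set \<Rightarrow> ('x \<Rightarrow> 'x \<Rightarrow> ennreal) \<Rightarrow> ('y \<Rightarrow> 'y \<Rightarrow> ennreal) \<Rightarrow> ('x \<Rightarrow> 'y) \<Rightarrow> bool" where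
  "controlled_fun X dX dY f \<longleftrightarrow>
     (\<forall>r\<ge>0. \<exists>R\<ge>0. \<forall>x\<in>X. \<forall>x'\<in>X. dX x x' \<le> ennreal r \<longrightarrow> dY (f x) (f x') \<le> ennreal R)"

definition defines_coarse_map ::
    "'x set \<Rightarrow> ('x \<Rightarrow> 'x \<Rightarrow> ennreal) \<Rightarrow> 'y set \<Rightarrow> ('y \<Rightarrow> 'y \<Rightarrow> ennreal) \<Rightarrow> ('y \<times> 'x) set \<Rightarrow> bool" where
  "defines_coarse_map X dX Y dY S \<longleftrightarrow>
     S \<subseteq> Y \<times> X \<and> controlled_rel dX dY S \<and> coarsely_dense X dX (snd ` S)"

definition represents_rel ::
    "'x set \<Rightarrow> ('x \<Rightarrow> 'x \<Rightarrow> ennreal) \<Rightarrow> 'y set \<Rightarrow> ('y \<Rightarrow> 'y \<Rightarrow> ennreal) \<Rightarrow> ('x \<Rightarrow> 'y) \<Rightarrow>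
     ('y \<times> 'x) set \<Rightarrow> bool" where
  "represents_rel X dX Y dY f S \<longleftrightarrow> f \<in> X \<rightarrow> Y \<and> controlled_fun X dX dY f \<and>
     hausdorff_edist (prod_edist dY dX) {(f x, x) | x. x \<in> X} S < \<infinity>"

definition uniformly_close ::
    "'x set \<Rightarrow> ('y \<Rightarrow> 'y \<Rightarrow> ennreal) \<Rightarrow> ('x \<Rightarrow> 'y) \<Rightarrow> ('x \<Rightarrow> 'y) \<Rightarrow> bool" where
  "uniformly_close X dY f g \<longleftrightarrow> (\<exists>K\<ge>0. \<forall>x\<in>X. dY (f x) (g x) \<le> ennreal K)"

text \<open>\<open>S\<close> is a coarse equivalence from \<open>X\<close> to \<open>Y\<close> with coarse inverse \<open>S'\<close>.\<close>

definition coarse_equivalence_with_inverse ::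
    "'x set \<Rightarrow> ('x \<Rightarrow> 'x \<Rightarrow> ennreal) \<Rightarrow> 'y set \<Rightarrow> ('y \<Rightarrow> 'y \<Rightarrow> ennreal) \<Rightarrow>
     ('y \<times> 'x) set \<Rightarrow> ('x \<times> 'y) set \<Rightarrow> bool" where
  "coarse_equivalence_with_inverse X dX Y dY S S' \<longleftrightarrow>
     defines_coarse_map X dX Y dY S \<and> defines_coarse_map Y dY X dX S' \<and>
     (\<exists>f f'. represents_rel X dX Y dY f S \<and> represents_rel Y dY X dX f' S' \<and>
        uniformly_close X dX (f' \<circ> f) id \<and> uniformly_close Y dY (f \<circ> f') id)"

end

theory Submission
  imports Defs
begin

text \<open>Since every \<open>1\<^sub>C\<close> with \<open>C \<subseteq> Y\<close> has propagation \<open>0\<close>, quasi-control of \<open>Ad(U\<^sup>*)\<close> gives for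
  each \<open>A\<close> of bounded diameter a set \<open>A'\<close> of bounded diameter such that \<open>U\<^sup>* 1\<^sub>C U v\<close> is almost supported
  in \<open>A'\<close> for all unit vectors \<open>v\<close> supported in \<open>A\<close>, uniformly in \<open>C\<close>. Decompose \<open>U v\<close> into its pieces
  \<open>1\<^sub>B U v\<close> over the partition of \<open>Y\<close>. A choice of signs shows that the parts of the
  \<open>U\<^sup>* 1\<^sub>B U v\<close> outside \<open>A'\<close> are small even in the square sum, so up to little mass each single
  \<open>1\<^sub>B U v\<close> lies mostly in \<open>U 1\<^sub>A\<^sub>' U\<^sup>*\<close>. Rank-one operators between vectors supported in \<open>A'\<close> have
  bounded propagation, so quasi-control of \<open>Ad(U)\<close> forces the remaining pieces to be uniformly
  close to each other. Hence \<open>U v\<close> is concentrated on a set of bounded diameter, which yields coarse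
  density of the projections of the relation. Control of the relation also comes from rank-one
  operators, and the relation of \<open>U\<^sup>*\<close> is the transpose of the relation of \<open>U\<close>.\<close>

section \<open>Operators on complex Hilbert spaces\<close>

lemma cinner_add_right: "cinner x (y + z) = cinner x y + cinner x (z::'h::complex_hilbert)"
  by (metis cinner_add_left cinner_commute complex_cnj_add)

lemma cinner_scaleC_right: "cinner x (scaleC c y) = c * cinner x (y::'h::complex_hilbert)"
  by (metis cinner_commute cinner_scaleC_left complex_cnj_cnj complex_cnj_mult)

lemma cinner_self: "cinner x x = complex_of_real ((norm (x::'h::complex_hilbert))\<^sup>2)"
proof (rule complex_eqI)
  show "Re (cinner x x) = Re (complex_of_real ((norm x)\<^sup>2))"
    by (simp add: power2_norm_eq_inner inner_eq_Re_cinner)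
  \<comment> \<open>Conjugate symmetry makes \<open>cinner x x\<close> equal to its own conjugate,
    so its imaginary part vanishes.\<close>
  have "Im (cinner x x) = - Im (cinner x x)"
    by (metis cinner_commute cnj.simps(2))
  then show "Im (cinner x x) = Im (complex_of_real ((norm x)\<^sup>2))" by simp
qed

lemma norm_scaleC: "norm (scaleC c (x::'h::complex_hilbert)) = cmod c * norm x"
proof -
  have "cinner (scaleC c x) (scaleC c x) = (c * cnj c) * cinner x x"
    by (simp add: cinner_scaleC_left cinner_scaleC_right)
  then have "complex_of_real ((norm (scaleC c x))\<^sup>2) = complex_of_real ((cmod c * norm x)\<^sup>2)"
    by (simp add: cinner_self complex_norm_square[symmetric] power_mult_distrib)
  then have "(norm (scaleC c x))\<^sup>2 = (cmod c * norm x)\<^sup>2"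
    using of_real_eq_iff by blast
  then show ?thesis by (simp add: power2_eq_iff_nonneg)
qed

text \<open>Complex Cauchy-Schwarz reduces to the real inequality: scaling \<open>x\<close> by
  \<open>cinner x y\<close> makes the inner product with \<open>y\<close> equal to the real number
  \<open>(cmod (cinner x y))\<^sup>2\<close>.\<close>

lemma cmod_cinner_le: "cmod (cinner x y) \<le> norm x * norm (y::'h::complex_hilbert)"
proof (cases "cinner x y = 0")
  case False
  let ?c = "cinner x y"
  have "(cmod ?c)\<^sup>2 = Re (cnj ?c * ?c)"
    by (simp add: cmod_power2 flip: power2_eq_square)
  also have "\<dots> = inner (scaleC ?c x) y"
    by (simp add: inner_eq_Re_cinner cinner_scaleC_left)
  also have "\<dots> \<le> cmod ?c * (norm x * norm y)"
    using norm_cauchy_schwarz[of "scaleC ?c x" y] by (simp add: norm_scaleC mult.assoc)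
  finally show ?thesis using False by (simp add: power2_eq_square)
qed simp

text \<open>The operator |a><b| of bra-ket notation. The vector \<open>b\<close> stands in the
  first, conjugate-linear slot of \<open>cinner\<close>, which makes the operator complex-linear in
  \<open>x\<close>.\<close>

definition rank_one :: "'h::complex_hilbert \<Rightarrow> 'h \<Rightarrow> ('h \<Rightarrow>\<^sub>L 'h)" where
  "rank_one a b = Blinfun (\<lambda>x. scaleC (cinner b x) a)"

lemma rank_one_apply: "rank_one a b x = scaleC (cinner b x) (a::'h::complex_hilbert)"
proof -
  have "bounded_linear (\<lambda>x. scaleC (cinner b x) a)"
  proof (rule bounded_linear_intro)
    show "scaleC (cinner b (x + y)) a = scaleC (cinner b x) a + scaleC (cinner b y) a" for x y
      by (simp add: cinner_add_right scaleC_add_left)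
    show "scaleC (cinner b (r *\<^sub>R x)) a = r *\<^sub>R scaleC (cinner b x) a" for r x
      by (metis cinner_scaleC_right scaleC_of_real scaleC_scaleC)
    show "norm (scaleC (cinner b x) a) \<le> norm x * (norm a * norm b)" for x
      using mult_right_mono[OF cmod_cinner_le[of b x] norm_ge_zero[of a]]
      by (simp add: norm_scaleC mult_ac)
  qed
  then show ?thesis by (simp add: rank_one_def bounded_linear_Blinfun_apply)
qed

lemma rank_one_in_bounded_ops: "rank_one a b \<in> bounded_ops"
  by (simp add: bounded_ops_def rank_one_apply cinner_scaleC_right scaleC_scaleC)

lemma norm_rank_one_le: "norm (rank_one a b) \<le> norm a * norm b"
proof (rule norm_blinfun_bound)
  show "norm (rank_one a b x) \<le> norm a * norm b * norm x" for x
    using mult_right_mono[OF cmod_cinner_le[of b x] norm_ge_zero[of a]]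
    by (simp add: rank_one_apply norm_scaleC mult_ac)
qed simp

section \<open>Adjoints and unitaries\<close>

lemma is_adjoint_inner: "is_adjoint T S \<Longrightarrow> inner (T x) y = inner x (S y)"
  by (simp add: is_adjoint_def inner_eq_Re_cinner)

lemma is_adjoint_sym: "is_adjoint T S \<Longrightarrow> is_adjoint S T"
  unfolding is_adjoint_def by (metis cinner_commute)

text \<open>The square of \<open>norm (S y)\<close> is the inner product of \<open>T (S y)\<close>
  with \<open>y\<close>. Cauchy-Schwarz bounds it, and one factor \<open>norm (S y)\<close>
  cancels.\<close>

lemma is_adjoint_norm_le:
  assumes "is_adjoint T S"
  shows "norm S \<le> norm T"
proof (rule norm_blinfun_bound)
  fix y
  have "(norm (S y))\<^sup>2 = inner (T (S y)) y"
    using assms by (simp add: power2_norm_eq_inner is_adjoint_inner)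
  also have "\<dots> \<le> norm (T (S y)) * norm y" by (rule norm_cauchy_schwarz)
  also have "\<dots> \<le> norm T * norm (S y) * norm y"
    by (intro mult_right_mono norm_blinfun norm_ge_zero)
  finally have "norm (S y) * norm (S y) \<le> (norm T * norm y) * norm (S y)"
    by (simp add: power2_eq_square mult_ac)
  then show "norm (S y) \<le> norm T * norm y"
    by (cases "norm (S y) = 0") (simp, simp only: mult_le_cancel_right, auto)
qed simp

lemma is_adjoint_norm_eq: "is_adjoint T S \<Longrightarrow> norm S = norm T"
  by (meson antisym is_adjoint_norm_le is_adjoint_sym)

text \<open>The adjoint of a unitary is its two-sided inverse, so it is again unitary. This lets
  every later result be applied with the two spaces exchanged.\<close>

lemma
  assumes "unitary_op U"
  shows unitary_op_cadjoint_unitary: "unitary_op (cadjoint U)"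
    and cadjoint_cadjoint: "cadjoint (cadjoint U) = U"
proof -
  note U = unitary_op_cadjoint[OF assms]
  have VU: "cadjoint U (U x) = x" for x
    using arg_cong[OF U(2), of "\<lambda>T. blinfun_apply T x"] by simp
  have UV: "U (cadjoint U x) = x" for x
    using arg_cong[OF U(3), of "\<lambda>T. blinfun_apply T x"] by simp
  have lin: "U (scaleC c x) = scaleC c (U x)" for c x
    using assms by (simp add: unitary_op_def bounded_ops_def)
  show "unitary_op (cadjoint U)"
    unfolding unitary_op_def bounded_ops_def
  proof (intro conjI CollectI allI)
    show "cadjoint U (scaleC c x) = scaleC c (cadjoint U x)" for c x
      by (metis UV VU lin)
    show "surj (blinfun_apply (cadjoint U))" by (metis VU surjI)
    show "cinner (cadjoint U x) (cadjoint U y) = cinner x y" for x y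
      using U(1) by (metis UV is_adjoint_def)
  qed
  show "cadjoint (cadjoint U) = U"
    by (rule cadjoint_eqI[OF is_adjoint_sym[OF U(1)]])
qed

lemma unitary_op_norm: "unitary_op U \<Longrightarrow> norm (blinfun_apply U x) = norm x"
  by (simp add: norm_eq_sqrt_inner inner_eq_Re_cinner unitary_op_def)

text \<open>Choosing the signs greedily replaces averaging over all signs.\<close>

lemma exists_signs:
  fixes g :: "'i \<Rightarrow> 'a::real_inner"
  assumes "finite F"
  shows "\<exists>G\<subseteq>F. (\<Sum>i\<in>F. (norm (g i))\<^sup>2) \<le> (norm (sum g G - sum g (F - G)))\<^sup>2"
  using assms
proof (induction F)
  case (insert i F)
  then obtain G where G: "G \<subseteq> F"
    and le: "(\<Sum>i\<in>F. (norm (g i))\<^sup>2) \<le> (norm (sum g G - sum g (F - G)))\<^sup>2" by blast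
  define s where "s = sum g G - sum g (F - G)"
  have fin: "finite G" "i \<notin> G" using insert.hyps G finite_subset by auto
  show ?case
  \<comment> \<open>The new index joins the side on which its cross term with the signed sum
    \<open>s\<close> is nonnegative, so the squared norm grows by at least that of
    \<open>g i\<close>.\<close>
  proof (cases "inner s (g i) \<ge> 0")
    case True
    have eq: "sum g (insert i G) - sum g (insert i F - insert i G) = s + g i"
      using fin insert.hyps by (simp add: s_def)
    have "(norm s)\<^sup>2 + (norm (g i))\<^sup>2 \<le> (norm (s + g i))\<^sup>2"
      using True by (simp add: power2_norm_eq_inner algebra_simps inner_commute)
    then have "(\<Sum>i\<in>insert i F. (norm (g i))\<^sup>2)
        \<le> (norm (sum g (insert i G) - sum g (insert i F - insert i G)))\<^sup>2"
      unfolding eq using le insert.hyps by (simp add: s_def)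
    then show ?thesis using G by blast
  next
    case False
    have "insert i F - G = insert i (F - G)" using fin by auto
    then have eq: "sum g G - sum g (insert i F - G) = s - g i"
      using fin insert.hyps by (simp add: s_def)
    have "(norm s)\<^sup>2 + (norm (g i))\<^sup>2 \<le> (norm (s - g i))\<^sup>2"
      using False by (simp add: power2_norm_eq_inner algebra_simps inner_commute)
    then have "(\<Sum>i\<in>insert i F. (norm (g i))\<^sup>2) \<le> (norm (sum g G - sum g (insert i F - G)))\<^sup>2"
      unfolding eq using le insert.hyps by (simp add: s_def)
    then show ?thesis using G by blast
  qed
qed simp

section \<open>Extended metric spaces and modules\<close>

lemma ediam_le_iff: "ediam d A \<le> D \<longleftrightarrow> (\<forall>a\<in>A. \<forall>a'\<in>A. d a a' \<le> D)"
  by (simp add: ediam_def SUP_le_iff)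

context extended_metric
begin

lemma dist_triangle_real:
  assumes "d x y \<le> ennreal a" "d y z \<le> ennreal b" "x \<in> X" "y \<in> X" "z \<in> X" "a \<ge> 0" "b \<ge> 0"
  shows "d x z \<le> ennreal (a + b)"
  using dist_triangle[of x y z] add_mono[OF assms(1,2)] assms(3-) by (auto simp: ennreal_plus)

lemma dist_through:
  assumes "d x x' \<le> ennreal a" "d x' y' \<le> ennreal b" "d y' y \<le> ennreal c"
    and "x \<in> X" "x' \<in> X" "y \<in> X" "y' \<in> X" "a \<ge> 0" "b \<ge> 0" "c \<ge> 0"
  shows "d x y \<le> ennreal (a + b + c)"
  using dist_triangle_real[OF dist_triangle_real[OF assms(1,2)] assms(3)] assms(4-) by simp

end

context coarse_module
begin

section \<open>Calculus of the projections attached to measurable sets\<close>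

lemma P_Int_apply: "A \<in> M \<Longrightarrow> A' \<in> M \<Longrightarrow> P A (P A' v) = P (A \<inter> A') v"
  by (simp add: P_Int)

lemma P_idem: "A \<in> M \<Longrightarrow> P A (P A v) = P A v"
  by (simp add: P_Int_apply)

lemma P_empty: "P {} = 0"
  using P_disjoint_Un[of "{}" "{}"] by simp

lemma P_adjoint: "A \<in> M \<Longrightarrow> is_adjoint (P A) (P A)"
  using projection by (auto simp: projection_op_def)

lemma P_in_bounded_ops: "A \<in> M \<Longrightarrow> P A \<in> bounded_ops"
  using projection by (auto simp: projection_op_def)

lemma inner_P: "A \<in> M \<Longrightarrow> inner (P A x) y = inner x (P A y)"
  by (rule is_adjoint_inner[OF P_adjoint])

lemma norm_P_sq: "A \<in> M \<Longrightarrow> (norm (P A v))\<^sup>2 = inner (P A v) v"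
  by (simp add: power2_norm_eq_inner inner_P P_idem)

lemma P_Compl:
  assumes "A \<in> M"
  shows "P (X - A) v = v - P A v"
proof -
  have "A \<union> (X - A) = X" using sets_into_space[OF assms] by blast
  then have "P X = P A + P (X - A)"
    using P_disjoint_Un[of A "X - A"] assms by auto
  then show ?thesis by (metis P_space add_diff_cancel_left' blinfun.add_left blinfun_apply_id_blinfun id_apply)
qed

lemma P_pythagoras:
  assumes "A \<in> M"
  shows "(norm (P A v))\<^sup>2 + (norm (P (X - A) v))\<^sup>2 = (norm v)\<^sup>2"
proof -
  have "X - A \<in> M" using assms by auto
  from norm_P_sq[OF this, of v] show ?thesis
    unfolding P_Compl[OF assms] norm_P_sq[OF assms] inner_diff_left power2_norm_eq_inner[of v]
    by linarith
qed

lemma norm_P_apply_le: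
  assumes "A \<in> M"
  shows "norm (P A v) \<le> norm v"
proof (rule power2_le_imp_le)
  show "(norm (P A v))\<^sup>2 \<le> (norm v)\<^sup>2"
    using P_pythagoras[OF assms, of v] zero_le_power2[of "norm (P (X - A) v)"] by linarith
qed simp

lemma norm_P_le: "A \<in> M \<Longrightarrow> norm (P A) \<le> 1"
  by (rule norm_blinfun_bound) (simp_all add: norm_P_apply_le)

lemma P_finite_Union:
  assumes "finite F" "F \<subseteq> M" "disjoint F"
  shows "P (\<Union>F) v = (\<Sum>A\<in>F. P A v)"
  using assms
proof (induction F)
  case (insert A F)
  have "A \<inter> \<Union>F = {}" using insert.hyps insert.prems by (auto simp: disjoint_def)
  moreover have "\<Union>F \<in> M" using insert by (intro finite_Union) auto
  ultimately have "P (\<Union>(insert A F)) v = P A v + P (\<Union>F) v"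
    using insert.prems by (simp add: P_disjoint_Un blinfun.add_left)
  then show ?case using insert by (simp add: pairwise_insert)
qed (simp add: P_empty)

text \<open>The squared norm of \<open>P A v\<close> equals \<open>inner (P A v) v\<close>, which is
  additive over disjoint sets; this is orthogonality of the pieces.\<close>

lemma norm_P_finite_Union:
  assumes "finite F" "F \<subseteq> M" "disjoint F"
  shows "(norm (P (\<Union>F) v))\<^sup>2 = (\<Sum>A\<in>F. (norm (P A v))\<^sup>2)"
proof -
  have "\<Union>F \<in> M" using assms by auto
  then have "(norm (P (\<Union>F) v))\<^sup>2 = inner (P (\<Union>F) v) v" by (rule norm_P_sq)
  also have "\<dots> = (\<Sum>A\<in>F. inner (P A v) v)"
    unfolding P_finite_Union[OF assms] inner_sum_left ..
  also have "\<dots> = (\<Sum>A\<in>F. (norm (P A v))\<^sup>2)"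
    using assms by (intro sum.cong) (auto simp: norm_P_sq)
  finally show ?thesis .
qed

text \<open>Sets at pointwise positive distance are disjoint, since \<open>d x x = 0\<close>, and
  the product of the three projections is the projection of the intersection.\<close>

lemma propagation_P:
  assumes "C \<in> M"
  shows "propagation_le d M P (P C) 0"
  unfolding propagation_le_def
proof (intro ballI impI)
  fix A A' assume A: "A \<in> M" "A' \<in> M" "separated_by d 0 A' A"
  have "A' \<inter> C \<inter> A = {}"
  proof (rule ccontr)
    assume "A' \<inter> C \<inter> A \<noteq> {}"
    then obtain x where "x \<in> A'" "x \<in> A" by blast
    then have "d x x > 0" "x \<in> X" using A sets_into_space by (auto simp: separated_by_def)
    then show False using dist_eq_0_iff[of x x] by simp
  qed
  moreover have "A' \<inter> C \<in> M" using A assms by auto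
  ultimately show "P A' o\<^sub>L P C o\<^sub>L P A = 0"
    using A assms P_Int[of A' C] P_Int[of "A' \<inter> C" A] by (simp add: P_empty)
qed

text \<open>If \<open>C'\<close> is further than \<open>r\<close> from \<open>C\<close>, then
  \<open>C\<close> meeting \<open>A\<close> and \<open>C'\<close> meeting \<open>A'\<close> would
  contradict \<open>near\<close>. So one of \<open>P C a\<close> and \<open>P C' a'\<close>
  vanishes, and with it the compressed operator.\<close>

lemma propagation_rank_one:
  assumes A: "A \<in> M" "A' \<in> M" "P A a = a" "P A' a' = a'"
    and near: "\<And>x x'. x \<in> A \<Longrightarrow> x' \<in> A' \<Longrightarrow> d x' x \<le> ennreal r"
  shows "propagation_le d M P (rank_one a' a) r"
  unfolding propagation_le_def
proof (intro ballI impI blinfun_eqI)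
  fix C C' v assume C: "C \<in> M" "C' \<in> M" "separated_by d r C' C"
  have "C \<inter> A = {} \<or> C' \<inter> A' = {}"
    using C near unfolding separated_by_def by (meson disjoint_iff IntE not_le)
  then have "P C a = 0 \<or> P C' a' = 0"
    using P_Int_apply[of C A a] P_Int_apply[of C' A' a'] A C by (auto simp: P_empty)
  moreover have "cinner a (P C v) = cinner (P C a) v"
    using P_adjoint[OF C(1)] by (simp add: is_adjoint_def)
  moreover have "P C' (scaleC c x) = scaleC c (P C' x)" for c x
    using P_in_bounded_ops[OF C(2)] by (simp add: bounded_ops_def)
  moreover have "cinner 0 v = 0" "scaleC 0 x = 0" "scaleC c 0 = (0::'h)" for c and x :: 'h
    using cmod_cinner_le[of 0 v] norm_scaleC[of 0 x] norm_scaleC[of c "0::'h"] by auto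
  ultimately show "(P C' o\<^sub>L rank_one a' a o\<^sub>L P C) v = (0::'h \<Rightarrow>\<^sub>L 'h) v"
    by (auto simp: rank_one_apply)
qed

end

text \<open>The metric neighbourhood of \<open>A\<close> may fail to be measurable. The union of all
  partition pieces that meet it is measurable by discreteness, and it is only slightly larger
  because the pieces have uniformly bounded diameter.\<close>

lemma (in discrete_module) bounded_measurable_neighbourhood:
  assumes "r \<ge> 0" "R \<ge> 0"
  shows "\<exists>\<rho>\<ge>0. \<forall>A\<in>M. ediam d A \<le> ennreal r \<longrightarrow>
    (\<exists>A'\<in>M. ediam d A' \<le> ennreal \<rho> \<and> separated_by d R (X - A') A)"
proof -
  obtain q \<A> where q: "q \<ge> 0" and part: "partition_on X \<A>" and "\<A> \<subseteq> M"
    and diam: "\<And>E. E \<in> \<A> \<Longrightarrow> ediam d E \<le> ennreal q"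
    and meas: "\<And>C. C \<subseteq> X \<Longrightarrow> (\<And>E. E \<in> \<A> \<Longrightarrow> C \<inter> E \<in> M) \<Longrightarrow> C \<in> M"
    using discrete by auto
  show ?thesis
  \<comment> \<open>The constant is the length of a path between two points of the union: across a
    piece and over to \<open>A\<close>, through \<open>A\<close>, then back the same way.\<close>
  proof (intro exI[of _ "(q + R) + r + (R + q)"] conjI ballI impI)
    show "0 \<le> (q + R) + r + (R + q)" using q assms by simp
    fix A assume A: "A \<in> M" "ediam d A \<le> ennreal r"
    have AX: "A \<subseteq> X" using sets_into_space A(1) .
    define N where "N = {E \<in> \<A>. \<exists>x\<in>E. \<exists>a\<in>A. d x a \<le> ennreal R}"
    have NA: "N \<subseteq> \<A>" by (auto simp: N_def)
    then have NX: "\<Union>N \<subseteq> X" using partition_onD1[OF part] by blast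
    show "\<exists>A'\<in>M. ediam d A' \<le> ennreal ((q + R) + r + (R + q)) \<and> separated_by d R (X - A') A"
    proof (intro bexI[of _ "\<Union>N"] conjI)
      show "\<Union>N \<in> M"
      proof (rule meas[OF NX])
        fix E assume E: "E \<in> \<A>"
        \<comment> \<open>The union meets each piece in all of it or not at all, so the test for
          measurability on pieces applies.\<close>
        have "\<Union>N \<inter> E = (if E \<in> N then E else {})"
          using disjointD[OF partition_onD2[OF part] E] NA by auto
        then show "\<Union>N \<inter> E \<in> M" using E \<open>\<A> \<subseteq> M\<close> by auto
      qed
      have near: "\<exists>a\<in>A. d y a \<le> ennreal (q + R)" if "y \<in> \<Union>N" for y
      proof -
        obtain E x a where E: "E \<in> \<A>" "y \<in> E" "x \<in> E" "a \<in> A" "d x a \<le> ennreal R"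
          using \<open>y \<in> \<Union>N\<close> by (auto simp: N_def)
        moreover have "d y x \<le> ennreal q" using diam[OF E(1)] E by (auto simp: ediam_le_iff)
        moreover have "x \<in> X" using E partition_onD1[OF part] by blast
        moreover have "y \<in> X" "a \<in> X" using AX NX that E(4) by blast+
        ultimately show ?thesis
          using dist_triangle_real[of y x q a R] q assms by blast
      qed
      show "ediam d (\<Union>N) \<le> ennreal ((q + R) + r + (R + q))"
        unfolding ediam_le_iff
      proof (intro ballI)
        fix y y' assume y: "y \<in> \<Union>N" "y' \<in> \<Union>N"
        then have yX: "y \<in> X" "y' \<in> X" using NX by blast+
        obtain a a' where a: "a \<in> A" "d y a \<le> ennreal (q + R)" "a' \<in> A" "d y' a' \<le> ennreal (q + R)"
          using near y by blast
        moreover have aX: "a \<in> X" "a' \<in> X" using a AX by blast+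
        moreover have "d a' y' \<le> ennreal (R + q)"
          using a(4) dist_sym[OF aX(2) yX(2)] by (simp add: add.commute)
        moreover have "d a a' \<le> ennreal r" using A a by (auto simp: ediam_le_iff)
        ultimately show "d y y' \<le> ennreal ((q + R) + r + (R + q))"
          using yX q assms by (intro dist_through[of y a _ a']) simp_all
      qed
      have "x \<in> \<Union>N" if *: "x \<in> X" "a \<in> A" "d x a \<le> ennreal R" for x a
      proof -
        obtain E where "E \<in> \<A>" "x \<in> E" using *(1) partition_onD1[OF part] by blast
        then show ?thesis using *(2,3) by (auto simp: N_def)
      qed
      then show "separated_by d R (X - \<Union>N) A"
        unfolding separated_by_def by (metis Diff_iff not_le)
    qed
  qed
qed

lemma mem_approx_rel:
  "(y, x) \<in> approx_rel dX MX PX dY MY PY T \<delta> R r \<longleftrightarrow>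
     (\<exists>A\<in>MX. \<exists>B\<in>MY. ediam dY B \<le> ennreal R \<and> ediam dX A \<le> ennreal r \<and>
       norm (PY B o\<^sub>L T o\<^sub>L PX A) > \<delta> \<and> y \<in> B \<and> x \<in> A)"
  unfolding approx_rel_def by blast

section \<open>Unitaries inducing quasi-controlled maps\<close>

locale quasi_controlled_unitary =
  X: discrete_module X dX MX PX + Y: discrete_module Y dY MY PY
  for X :: "'x set" and dX MX and PX :: "'x set \<Rightarrow> ('h::complex_hilbert \<Rightarrow>\<^sub>L 'h)"
    and Y :: "'y set" and dY MY and PY :: "'y set \<Rightarrow> ('k::complex_hilbert \<Rightarrow>\<^sub>L 'k)" +
  fixes U :: "'h \<Rightarrow>\<^sub>L 'k"
  assumes unitary: "unitary_op U"
    and quasi_controlled: "quasi_controlled dX MX PX dY MY PY (Ad U)"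
    and quasi_controlled_inverse: "quasi_controlled dY MY PY dX MX PX (Ad (cadjoint U))"
begin

text \<open>The assumptions are symmetric under exchanging the two modules and replacing
  \<open>U\<close> by its adjoint, because the adjoint of the adjoint is \<open>U\<close>.\<close>

lemma flip: "quasi_controlled_unitary Y dY MY PY X dX MX PX (cadjoint U)"
  using unitary quasi_controlled quasi_controlled_inverse
  by (intro_locales, unfold_locales)
    (simp_all add: unitary_op_cadjoint_unitary cadjoint_cadjoint)

lemma adjoint: "is_adjoint U (cadjoint U)"
  by (rule unitary_op_cadjoint(1)[OF unitary])

text \<open>\<open>Ad U\<close> carries |a'><a| to |Ua'><Ua|. Testing the compression on
  \<open>PY B (U a)\<close> itself gives the lower bound.\<close>

lemma norm_Ad_rank_one_ge:
  assumes "B \<in> MY" "B' \<in> MY"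
  shows "norm (PY B (U a)) * norm (PY B' (U a')) \<le> norm (PY B' o\<^sub>L Ad U (rank_one a' a) o\<^sub>L PY B)"
    (is "_ \<le> norm ?T")
proof (cases "PY B (U a) = 0")
  case False
  let ?z = "PY B (U a)"
  have "cinner a (cadjoint U ?z) = cinner (U a) (PY B ?z)"
    using adjoint assms by (simp add: is_adjoint_def Y.P_idem)
  also have "\<dots> = cinner ?z ?z"
    using Y.P_adjoint[OF assms(1)] by (simp add: is_adjoint_def)
  finally have "?T ?z = PY B' (U (scaleC (complex_of_real ((norm ?z)\<^sup>2)) a'))"
    using assms by (simp add: Ad_def rank_one_apply Y.P_idem cinner_self)
  then have "norm (?T ?z) = (norm ?z)\<^sup>2 * norm (PY B' (U a'))"
    by (simp add: scaleC_of_real blinfun.scaleR_right del: of_real_power)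
  moreover have "norm (?T ?z) \<le> norm ?T * norm ?z" by (rule norm_blinfun)
  ultimately show ?thesis using False
    by (simp add: power2_eq_square mult.assoc mult.commute[of "norm ?T"])
qed simp

text \<open>If \<open>B\<close> and \<open>B'\<close> were far apart, quasi-control would make the
  compression of \<open>Ad U (rank_one a' a)\<close> too small for the lower bound just shown. The
  radius depends only on \<open>r\<close> and \<epsilon>.\<close>

lemma images_close:
  assumes "r \<ge> 0" "\<epsilon> > 0"
  shows "\<exists>R\<ge>0. \<forall>A\<in>MX. \<forall>A'\<in>MX. \<forall>B\<in>MY. \<forall>B'\<in>MY. \<forall>a a'.
    (\<forall>x\<in>A. \<forall>x'\<in>A'. dX x' x \<le> ennreal r) \<longrightarrow> PX A a = a \<longrightarrow> PX A' a' = a' \<longrightarrow>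
    \<epsilon> * (norm a * norm a') < norm (PY B (U a)) * norm (PY B' (U a')) \<longrightarrow>
    (\<exists>b\<in>B. \<exists>b'\<in>B'. dY b' b \<le> ennreal R)"
proof -
  obtain R where "R \<ge> 0" and R: "\<And>t B B'. t \<in> bounded_ops \<Longrightarrow> propagation_le dX MX PX t r \<Longrightarrow>
      B \<in> MY \<Longrightarrow> B' \<in> MY \<Longrightarrow> separated_by dY R B' B \<Longrightarrow> norm (PY B' o\<^sub>L Ad U t o\<^sub>L PY B) \<le> \<epsilon> * norm t"
    using quasi_controlled assms unfolding quasi_controlled_def by metis
  show ?thesis
  proof (intro exI[of _ R] conjI ballI allI impI)
    show "R \<ge> 0" by fact
    fix A A' B B' a a'
    assume *: "A \<in> MX" "A' \<in> MX" "B \<in> MY" "B' \<in> MY" "\<forall>x\<in>A. \<forall>x'\<in>A'. dX x' x \<le> ennreal r"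
      "PX A a = a" "PX A' a' = a'"
      "\<epsilon> * (norm a * norm a') < norm (PY B (U a)) * norm (PY B' (U a'))"
    have "\<epsilon> * norm (rank_one a' a) \<le> \<epsilon> * (norm a * norm a')"
      using norm_rank_one_le[of a' a] \<open>\<epsilon> > 0\<close> by (simp add: mult.commute)
    then have "\<epsilon> * norm (rank_one a' a) < norm (PY B' o\<^sub>L Ad U (rank_one a' a) o\<^sub>L PY B)"
      using *(8) norm_Ad_rank_one_ge[OF *(3,4), of a a'] by linarith
    moreover have "propagation_le dX MX PX (rank_one a' a) r"
      using * by (intro X.propagation_rank_one[of A A']) auto
    ultimately have "\<not> separated_by dY R B' B"
      using R[of "rank_one a' a" B B'] * by (auto simp: rank_one_in_bounded_ops)
    then show "\<exists>b\<in>B. \<exists>b'\<in>B'. dY b' b \<le> ennreal R"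
      by (auto simp: separated_by_def not_less)
  qed
qed

text \<open>All projections \<open>PY C\<close> have propagation 0 and norm at most 1, so a single
  radius from quasi-control of \<open>Ad (cadjoint U)\<close> serves every \<open>C\<close>. A
  measurable neighbourhood of \<open>A\<close> of that radius is the required \<open>A'\<close>.
  Uniformity in \<open>C\<close> is what later allows arbitrary unions of pieces.\<close>

lemma pieces_almost_supported:
  assumes "r \<ge> 0" "\<epsilon> > 0"
  shows "\<exists>\<rho>\<ge>0. \<forall>A\<in>MX. ediam dX A \<le> ennreal r \<longrightarrow> (\<exists>A'\<in>MX. ediam dX A' \<le> ennreal \<rho> \<and>
    (\<forall>C\<in>MY. \<forall>v. PX A v = v \<longrightarrow> norm (PX (X - A') (cadjoint U (PY C (U v)))) \<le> \<epsilon> * norm v))"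
proof -
  obtain R where "R \<ge> 0" and R: "\<And>t A A'. t \<in> bounded_ops \<Longrightarrow> propagation_le dY MY PY t 0 \<Longrightarrow>
      A \<in> MX \<Longrightarrow> A' \<in> MX \<Longrightarrow> separated_by dX R A' A \<Longrightarrow>
      norm (PX A' o\<^sub>L Ad (cadjoint U) t o\<^sub>L PX A) \<le> \<epsilon> * norm t"
    using quasi_controlled_inverse \<open>\<epsilon> > 0\<close> unfolding quasi_controlled_def by (metis order_refl)
  have bound: "norm (PX (X - A') (cadjoint U (PY C (U v)))) \<le> \<epsilon> * norm v"
    if "A \<in> MX" "A' \<in> MX" "separated_by dX R (X - A') A" "C \<in> MY" "PX A v = v" for A A' C v
  proof -
    let ?T = "PX (X - A') o\<^sub>L Ad (cadjoint U) (PY C) o\<^sub>L PX A"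
    have "PX (X - A') (cadjoint U (PY C (U v))) = ?T v"
      using that by (simp add: Ad_def cadjoint_cadjoint[OF unitary])
    then have "norm (PX (X - A') (cadjoint U (PY C (U v)))) \<le> norm ?T * norm v"
      by (simp only: norm_blinfun)
    also have "norm ?T \<le> \<epsilon> * norm (PY C)"
      using that by (intro R Y.P_in_bounded_ops Y.propagation_P) auto
    also have "\<dots> \<le> \<epsilon> * 1"
      using that \<open>\<epsilon> > 0\<close> by (intro mult_left_mono Y.norm_P_le) auto
    finally show ?thesis by (simp add: mult_right_mono)
  qed
  show ?thesis
    using X.bounded_measurable_neighbourhood[OF \<open>r \<ge> 0\<close> \<open>R \<ge> 0\<close>] bound by meson
qed

lemma image_concentrated:
  assumes "r \<ge> 0" "0 < \<delta>" "\<delta> < 1"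
  shows "\<exists>R\<ge>0. \<forall>A\<in>MX. ediam dX A \<le> ennreal r \<longrightarrow> (\<forall>v. PX A v = v \<longrightarrow> norm v = 1 \<longrightarrow>
    (\<exists>B\<in>MY. ediam dY B \<le> ennreal R \<and> norm (PY B (U v)) > \<delta>))"
proof -
  \<comment> \<open>The admissible loss of mass: at most \<open>e / 2\<close> from cutting down to
    finitely many pieces and at most \<open>e / 2\<close> from discarding bad pieces leave at least
    \<open>1 - e\<close>, which exceeds \<open>\<delta>\<^sup>2\<close>.\<close>
  define e where "e = (1 - \<delta>\<^sup>2) / 2"
  have \<delta>2: "0 < \<delta>\<^sup>2" "\<delta>\<^sup>2 < 1"
    using assms by (auto simp: abs_square_less_1)
  then have e: "0 < e" "e < 1 / 2" "1 - e > \<delta>\<^sup>2" by (simp_all add: e_def field_simps)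
  have e2: "e\<^sup>2 \<le> e / 2" using e mult_left_mono[of e "1/2" e] by (simp add: power2_eq_square)
  obtain q \<B> where q: "q \<ge> 0" and part: "partition_on Y \<B>" and \<B>M: "\<B> \<subseteq> MY"
    and diam: "\<And>E. E \<in> \<B> \<Longrightarrow> ediam dY E \<le> ennreal q"
    and sum: "\<And>w. ((\<lambda>B. PY B w) has_sum w) \<B>"
    using Y.discrete by auto
  obtain \<rho> where "\<rho> \<ge> 0" and \<rho>: "\<And>A. A \<in> MX \<Longrightarrow> ediam dX A \<le> ennreal r \<Longrightarrow>
      \<exists>A'\<in>MX. ediam dX A' \<le> ennreal \<rho> \<and> (\<forall>C\<in>MY. \<forall>v. PX A v = v \<longrightarrow>
        norm (PX (X - A') (cadjoint U (PY C (U v)))) \<le> e / 4 * norm v)"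
    using pieces_almost_supported[OF \<open>r \<ge> 0\<close>, of "e / 4"] e by auto
  obtain R where "R \<ge> 0" and R: "\<And>A A' B B' a a'. A \<in> MX \<Longrightarrow> A' \<in> MX \<Longrightarrow> B \<in> MY \<Longrightarrow> B' \<in> MY \<Longrightarrow>
      (\<forall>x\<in>A. \<forall>x'\<in>A'. dX x' x \<le> ennreal \<rho>) \<Longrightarrow> PX A a = a \<Longrightarrow> PX A' a' = a' \<Longrightarrow>
      1 / 2 * (norm a * norm a') < norm (PY B (U a)) * norm (PY B' (U a')) \<Longrightarrow>
      \<exists>b\<in>B. \<exists>b'\<in>B'. dY b' b \<le> ennreal R"
    using images_close[OF \<open>\<rho> \<ge> 0\<close>, of "1 / 2"] by auto
  show ?thesis
  proof (intro exI[of _ "q + R + q"] conjI ballI allI impI)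
    show "0 \<le> q + R + q" using q \<open>R \<ge> 0\<close> by simp
    fix A v assume A: "A \<in> MX" "ediam dX A \<le> ennreal r" and v: "PX A v = v" "norm v = 1"
    obtain A' where A': "A' \<in> MX" "ediam dX A' \<le> ennreal \<rho>"
      and supp: "\<And>C. C \<in> MY \<Longrightarrow> norm (PX (X - A') (cadjoint U (PY C (U v)))) \<le> e / 4"
      using \<rho>[OF A] v by force
    define w where "w = U v"
    define u where "u B = PY B w" for B
    define g where "g B = PX (X - A') (cadjoint U (u B))" for B
    have w: "norm w = 1" using v unitary_op_norm[OF unitary] by (simp add: w_def)
    \<comment> \<open>Strong convergence of the partition sum provides finitely many pieces that
      carry almost all of \<open>w\<close>.\<close>
    obtain F where F: "finite F" "F \<subseteq> \<B>" and "dist (sum u F) w \<le> e"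
      using sum[of w] e unfolding has_sum_def u_def[abs_def] tendsto_iff
        eventually_finite_subsets_at_top by (metis less_imp_le order_refl)
    have disj: "disjoint G" if "G \<subseteq> F" for G
      using partition_onD2[OF part] that F by (meson pairwise_subset subset_trans)
    have finM: "finite G" "G \<subseteq> MY" "\<Union>G \<in> MY" if "G \<subseteq> F" for G
      using that F \<B>M finite_subset[OF that] by (auto intro!: Y.finite_Union)
    have mass: "(norm (PY (\<Union>G) w))\<^sup>2 = (\<Sum>B\<in>G. (norm (u B))\<^sup>2)" if "G \<subseteq> F" for G
      unfolding u_def by (rule Y.norm_P_finite_Union[OF finM(1,2) disj]) (use that in auto)
    have split: "PY (\<Union>G) w = sum u G" if "G \<subseteq> F" for G
      unfolding u_def by (rule Y.P_finite_Union[OF finM(1,2) disj]) (use that in auto)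
    have "norm (PY (Y - \<Union>F) w) \<le> e"
      using \<open>dist (sum u F) w \<le> e\<close> finM(3)[of F]
      by (simp add: Y.P_Compl split dist_norm norm_minus_commute)
    then have "(norm (PY (Y - \<Union>F) w))\<^sup>2 \<le> e\<^sup>2" by (rule power_mono) simp
    then have massF: "(\<Sum>B\<in>F. (norm (u B))\<^sup>2) \<ge> 1 - e / 2"
      using Y.P_pythagoras[of "\<Union>F" w] finM(3)[of F] w e2 by (simp add: mass)
    have g_sum: "norm (sum g G) \<le> e / 4" if "G \<subseteq> F" for G
    proof -
      have "sum g G = PX (X - A') (cadjoint U (PY (\<Union>G) w))"
        by (simp add: split[OF that] g_def blinfun.sum_right)
      then show ?thesis using supp[OF finM(3)[OF that]] by (simp add: w_def)
    qed
    \<comment> \<open>For the right signs the square sum is bounded by one signed sum, a difference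
      of two sums over subsets. Each of these comes from projecting \<open>w\<close> to a union of
      pieces, hence has norm at most \<open>e / 4\<close>.\<close>
    have gF: "(\<Sum>B\<in>F. (norm (g B))\<^sup>2) \<le> (e / 2)\<^sup>2"
    proof -
      obtain G where G: "G \<subseteq> F"
        "(\<Sum>B\<in>F. (norm (g B))\<^sup>2) \<le> (norm (sum g G - sum g (F - G)))\<^sup>2"
        using exists_signs[OF F(1)] by blast
      have "norm (sum g G - sum g (F - G)) \<le> e / 2"
        using norm_triangle_ineq4[of "sum g G" "sum g (F - G)"] g_sum[OF G(1)] g_sum[of "F - G"]
        by auto
      then have "(norm (sum g G - sum g (F - G)))\<^sup>2 \<le> (e / 2)\<^sup>2" by (rule power_mono) simp
      then show ?thesis using G(2) by linarith
    qed
    \<comment> \<open>The good pieces: nonzero, with at most half of their norm outside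
      \<open>A'\<close> after pulling back. Every other piece satisfies
      \<open>norm (u B) \<le> 2 * norm (g B)\<close>, so the bound on the square sum of
      \<open>g\<close> limits the discarded mass.\<close>
    define G where "G = {B \<in> F. u B \<noteq> 0 \<and> norm (g B) \<le> norm (u B) / 2}"
    have GF: "G \<subseteq> F" by (auto simp: G_def)
    have "(\<Sum>B\<in>F - G. (norm (u B))\<^sup>2) \<le> (\<Sum>B\<in>F - G. 4 * (norm (g B))\<^sup>2)"
    proof (rule sum_mono)
      fix B assume "B \<in> F - G"
      then have "norm (u B) \<le> 2 * norm (g B)" by (auto simp: G_def)
      then have "(norm (u B))\<^sup>2 \<le> (2 * norm (g B))\<^sup>2" by (rule power_mono) simp
      then show "(norm (u B))\<^sup>2 \<le> 4 * (norm (g B))\<^sup>2" by (simp add: power_mult_distrib)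
    qed
    also have "\<dots> \<le> (\<Sum>B\<in>F. 4 * (norm (g B))\<^sup>2)"
      by (rule sum_mono2) (use F in auto)
    also have "\<dots> \<le> e / 2"
      using gF e2 by (simp add: sum_distrib_left[symmetric] power_divide)
    finally have "(\<Sum>B\<in>G. (norm (u B))\<^sup>2) \<ge> 1 - e"
      using massF sum.subset_diff[OF GF F(1), of "\<lambda>B. (norm (u B))\<^sup>2"] by linarith
    then have "\<delta>\<^sup>2 < (norm (PY (\<Union>G) w))\<^sup>2" using e mass[OF GF] by linarith
    then have "\<delta> < norm (PY (\<Union>G) w)" by (rule power2_less_imp_less) simp
    moreover have "ediam dY (\<Union>G) \<le> ennreal (q + R + q)"
      unfolding ediam_le_iff
    proof (intro ballI)
      fix y y' assume "y \<in> \<Union>G" "y' \<in> \<Union>G"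
      then obtain B B' where B: "B \<in> G" "B' \<in> G" "y \<in> B" "y' \<in> B'" by auto
      then have BM: "B \<in> MY" "B' \<in> MY" "B \<in> \<B>" "B' \<in> \<B>" using GF F \<B>M by auto
      then have BY: "B \<subseteq> Y" "B' \<subseteq> Y" using Y.sets_into_space by auto
      \<comment> \<open>The part of the pulled-back piece inside \<open>A'\<close>. At most a
        quarter of the squared norm is lost, which is the source of the factor \<open>3 / 4\<close>
        below.\<close>
      define a where "a E = PX A' (cadjoint U (u E))" for E
      have big: "norm (a E) \<le> norm (u E)" "3 / 4 * norm (u E) \<le> norm (PY E (U (a E)))" "norm (u E) > 0"
        if "E \<in> G" for E
      proof -
        have E: "E \<in> MY" "u E \<noteq> 0" "norm (g E) \<le> norm (u E) / 2"
          using that finM(2)[OF GF] by (auto simp: G_def)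
        have iso: "norm (cadjoint U (u E)) = norm (u E)"
          by (rule unitary_op_norm[OF unitary_op_cadjoint_unitary[OF unitary]])
        show "norm (a E) \<le> norm (u E)" "norm (u E) > 0"
          using X.norm_P_apply_le[OF A'(1), of "cadjoint U (u E)"] iso E by (auto simp: a_def)
        have "(norm (g E))\<^sup>2 \<le> (norm (u E) / 2)\<^sup>2" using E(3) by (rule power_mono) simp
        then have "3 / 4 * (norm (u E))\<^sup>2 \<le> (norm (a E))\<^sup>2"
          using X.P_pythagoras[OF A'(1), of "cadjoint U (u E)"] iso
          by (simp add: a_def g_def power_divide)
        also have "\<dots> = inner (U (a E)) (u E)"
          by (simp add: a_def X.norm_P_sq[OF A'(1)] is_adjoint_inner[OF adjoint])
        also have "\<dots> = inner (PY E (U (a E))) (u E)"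
          using E by (simp add: Y.inner_P u_def Y.P_idem)
        also have "\<dots> \<le> norm (PY E (U (a E))) * norm (u E)" by (rule norm_cauchy_schwarz)
        finally have "(3 / 4 * norm (u E)) * norm (u E) \<le> norm (PY E (U (a E))) * norm (u E)"
          by (simp add: power2_eq_square)
        then show "3 / 4 * norm (u E) \<le> norm (PY E (U (a E)))"
          using E(2) by (simp only: mult_le_cancel_right) simp
      qed
      have "1 / 2 * (norm (a B') * norm (a B)) \<le> 1 / 2 * (norm (u B') * norm (u B))"
        using big(1) B by (intro mult_left_mono mult_mono) auto
      \<comment> \<open>The threshold \<open>1 / 2\<close> lies below 9/16, and strictness uses that
        good pieces are nonzero. Thus \<open>images_close\<close> applies with \<open>A'\<close> in
        both source positions.\<close>
      also have "\<dots> < (3 / 4 * norm (u B')) * (3 / 4 * norm (u B))"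
        using mult_pos_pos[OF big(3)[OF B(2)] big(3)[OF B(1)]] by simp
      also have "\<dots> \<le> norm (PY B' (U (a B'))) * norm (PY B (U (a B)))"
        using big(2) B by (intro mult_mono) auto
      finally obtain b b' where b: "b' \<in> B'" "b \<in> B" "dY b b' \<le> ennreal R"
        using R[of A' A' B' B "a B'" "a B"] A' BM by (auto simp: ediam_le_iff a_def X.P_idem)
      moreover have "dY y b \<le> ennreal q" "dY b' y' \<le> ennreal q"
        using diam BM B b by (auto simp: ediam_le_iff)
      ultimately show "dY y y' \<le> ennreal (q + R + q)"
        using BY B q \<open>R \<ge> 0\<close> by (intro Y.dist_through[of y b _ b']) auto
    qed
    ultimately show "\<exists>B\<in>MY. ediam dY B \<le> ennreal (q + R + q) \<and> norm (PY B (U v)) > \<delta>"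
      using finM(3)[OF GF] by (auto simp: w_def)
  qed
qed

section \<open>Transpose, control and density of the approximating relation\<close>

lemma approx_rel_subset: "approx_rel dX MX PX dY MY PY U \<delta> R r \<subseteq> Y \<times> X"
  using X.sets_into_space Y.sets_into_space by (fastforce simp: approx_rel_def)

text \<open>The compressions of \<open>U\<close> and of \<open>cadjoint U\<close> by the same two
  sets are adjoint to each other and so have equal norm.\<close>

lemma approx_rel_cadjoint:
  "approx_rel dY MY PY dX MX PX (cadjoint U) \<delta> r R = (approx_rel dX MX PX dY MY PY U \<delta> R r)\<inverse>"
proof -
  have "norm (PX A o\<^sub>L cadjoint U o\<^sub>L PY B) = norm (PY B o\<^sub>L U o\<^sub>L PX A)"
    if "A \<in> MX" "B \<in> MY" for A B
  proof -
    have "is_adjoint (PY B o\<^sub>L U o\<^sub>L PX A) (PX A o\<^sub>L cadjoint U o\<^sub>L PY B)"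
      using X.P_adjoint[OF that(1)] Y.P_adjoint[OF that(2)] adjoint by (simp add: is_adjoint_def)
    then show ?thesis by (rule is_adjoint_norm_eq)
  qed
  then have "(x, y) \<in> approx_rel dY MY PY dX MX PX (cadjoint U) \<delta> r R \<longleftrightarrow>
      (y, x) \<in> approx_rel dX MX PX dY MY PY U \<delta> R r" for x y
    unfolding mem_approx_rel by metis
  then show ?thesis by auto
qed

text \<open>Pairs with nearby \<open>X\<close>-coordinates come from sets \<open>A\<close>,
  \<open>A'\<close> within \<open>r + \<rho> + r\<close> of each other. Vectors witnessing the two
  norm bounds have images in \<open>B\<close>, \<open>B'\<close> large enough for
  \<open>images_close\<close> with threshold \<open>\<delta> * \<delta>\<close>.\<close>

lemma approx_rel_controlled:
  assumes "r \<ge> 0" "R \<ge> 0" "\<delta> > 0"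
  shows "controlled_rel dX dY (approx_rel dX MX PX dY MY PY U \<delta> R r)"
  unfolding controlled_rel_def
proof (intro allI impI)
  fix \<rho> :: real assume "\<rho> \<ge> 0"
  obtain K where "K \<ge> 0" and K: "\<And>A A' B B' a a'. A \<in> MX \<Longrightarrow> A' \<in> MX \<Longrightarrow> B \<in> MY \<Longrightarrow> B' \<in> MY \<Longrightarrow>
      (\<forall>x\<in>A. \<forall>x'\<in>A'. dX x' x \<le> ennreal (r + \<rho> + r)) \<Longrightarrow> PX A a = a \<Longrightarrow> PX A' a' = a' \<Longrightarrow>
      \<delta> * \<delta> * (norm a * norm a') < norm (PY B (U a)) * norm (PY B' (U a')) \<Longrightarrow>
      \<exists>b\<in>B. \<exists>b'\<in>B'. dY b' b \<le> ennreal K"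
    using images_close[of "r + \<rho> + r" "\<delta> * \<delta>"] assms \<open>\<rho> \<ge> 0\<close> by auto
  \<comment> \<open>An operator norm above \<delta> is exceeded relatively at some vector; replacing
    it by its projection to \<open>A\<close> keeps the image and does not increase the norm.\<close>
  have witness: "\<exists>a. PX A a = a \<and> \<delta> * norm a < norm (PY B (U a))"
    if AB: "A \<in> MX" "norm (PY B o\<^sub>L U o\<^sub>L PX A) > \<delta>" for A B
  proof -
    obtain x where "\<not> norm ((PY B o\<^sub>L U o\<^sub>L PX A) x) \<le> \<delta> * norm x"
      using AB norm_blinfun_bound[of \<delta> "PY B o\<^sub>L U o\<^sub>L PX A"] assms by (meson less_imp_le not_le)
    then have "\<delta> * norm x < norm (PY B (U (PX A x)))" by simp
    moreover have "\<delta> * norm (PX A x) \<le> \<delta> * norm x"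
      using X.norm_P_apply_le[OF AB(1)] assms by simp
    ultimately show ?thesis using X.P_idem[OF AB(1)] by (meson le_less_trans)
  qed
  have "dY y y' \<le> ennreal (R + K + R)"
    if yx: "(y, x) \<in> approx_rel dX MX PX dY MY PY U \<delta> R r" and yx': "(y', x') \<in> approx_rel dX MX PX dY MY PY U \<delta> R r"
      and xx': "dX x x' \<le> ennreal \<rho>" for y x y' x'
  proof -
    obtain A B where A: "A \<in> MX" "B \<in> MY" "ediam dY B \<le> ennreal R" "ediam dX A \<le> ennreal r"
      "norm (PY B o\<^sub>L U o\<^sub>L PX A) > \<delta>" "y \<in> B" "x \<in> A"
      using yx unfolding mem_approx_rel by blast
    obtain A' B' where A': "A' \<in> MX" "B' \<in> MY" "ediam dY B' \<le> ennreal R" "ediam dX A' \<le> ennreal r"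
      "norm (PY B' o\<^sub>L U o\<^sub>L PX A') > \<delta>" "y' \<in> B'" "x' \<in> A'"
      using yx' unfolding mem_approx_rel by blast
    have sub: "A \<subseteq> X" "A' \<subseteq> X" "B \<subseteq> Y" "B' \<subseteq> Y"
      using A A' X.sets_into_space Y.sets_into_space by auto
    obtain a a' where a: "PX A a = a" "\<delta> * norm a < norm (PY B (U a))"
      and a': "PX A' a' = a'" "\<delta> * norm a' < norm (PY B' (U a'))"
      using witness A A' by meson
    have "(\<delta> * norm a') * (\<delta> * norm a) < norm (PY B' (U a')) * norm (PY B (U a))"
      using a a' assms by (intro mult_strict_mono') auto
    then have "\<delta> * \<delta> * (norm a' * norm a) < norm (PY B' (U a')) * norm (PY B (U a))"
      by (simp add: mult_ac)
    moreover have "dX z z' \<le> ennreal (r + \<rho> + r)" if "z \<in> A" "z' \<in> A'" for z z'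
      using that A A' sub xx' assms \<open>\<rho> \<ge> 0\<close>
      by (intro X.dist_through[of z x _ x']) (auto simp: ediam_le_iff)
    ultimately obtain b b' where "b' \<in> B'" "b \<in> B" "dY b b' \<le> ennreal K"
      using K[of A' A B' B a' a] A A' a a' by auto
    then show ?thesis
      using A A' sub assms \<open>K \<ge> 0\<close> by (intro Y.dist_through[of y b _ b']) (auto simp: ediam_le_iff)
  qed
  then show "\<exists>R'\<ge>0. \<forall>(y, x)\<in>approx_rel dX MX PX dY MY PY U \<delta> R r.
      \<forall>(y', x')\<in>approx_rel dX MX PX dY MY PY U \<delta> R r. dX x x' \<le> ennreal \<rho> \<longrightarrow> dY y y' \<le> ennreal R'"
    using assms \<open>K \<ge> 0\<close> by (intro exI[of _ "R + K + R"]) auto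
qed

text \<open>Each \<open>A\<close> of small diameter with \<open>PX A \<noteq> 0\<close> contains the
  support of a unit vector. Its image is concentrated on a bounded \<open>B\<close>, so
  \<open>B \<times> A\<close> lies in the relation, and faithfulness makes the union of such
  \<open>A\<close> coarsely dense.\<close>

lemma approx_rel_dense:
  assumes "faithful_module X dX MX PX" "0 < \<delta>" "\<delta> < 1"
  shows "\<exists>r\<^sub>0\<ge>0. \<exists>R\<^sub>0\<ge>0. \<forall>r\<ge>r\<^sub>0. \<forall>R\<ge>R\<^sub>0.
    coarsely_dense X dX (snd ` approx_rel dX MX PX dY MY PY U \<delta> R r)"
proof -
  obtain r0 where "r0 \<ge> 0" and dense: "coarsely_dense X dX (\<Union>{A \<in> MX. ediam dX A \<le> ennreal r0 \<and> PX A \<noteq> 0})"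
    using faithful_module.faithful[OF assms(1)] by blast
  obtain R0 where "R0 \<ge> 0" and R0: "\<And>A v. A \<in> MX \<Longrightarrow> ediam dX A \<le> ennreal r0 \<Longrightarrow> PX A v = v \<Longrightarrow>
      norm v = 1 \<Longrightarrow> \<exists>B\<in>MY. ediam dY B \<le> ennreal R0 \<and> norm (PY B (U v)) > \<delta>"
    using image_concentrated[OF \<open>r0 \<ge> 0\<close> assms(2,3)] by metis
  have "coarsely_dense X dX (snd ` approx_rel dX MX PX dY MY PY U \<delta> R r)"
    if "r \<ge> r0" "R \<ge> R0" for r R
  proof -
    have "A \<subseteq> snd ` approx_rel dX MX PX dY MY PY U \<delta> R r"
      if A: "A \<in> MX" "ediam dX A \<le> ennreal r0" "PX A \<noteq> 0" for A
    proof -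
      obtain x where "PX A x \<noteq> 0" using A(3) by (metis blinfun_eqI zero_blinfun.rep_eq)
      define v where "v = sgn (PX A x)"
      have v: "PX A v = v" "norm v = 1"
        using \<open>PX A x \<noteq> 0\<close> by (simp_all add: v_def sgn_div_norm blinfun.scaleR_right X.P_idem[OF A(1)])
      obtain B where B: "B \<in> MY" "ediam dY B \<le> ennreal R0" "norm (PY B (U v)) > \<delta>"
        using R0[OF A(1,2) v] by blast
      have "norm (PY B (U v)) \<le> norm (PY B o\<^sub>L U o\<^sub>L PX A)"
        using norm_blinfun[of "PY B o\<^sub>L U o\<^sub>L PX A" v] v by simp
      then have "norm (PY B o\<^sub>L U o\<^sub>L PX A) > \<delta>" using B by linarith
      moreover have "ediam dX A \<le> ennreal r" "ediam dY B \<le> ennreal R"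
        using A B \<open>r \<ge> r0\<close> \<open>R \<ge> R0\<close> by (meson ennreal_leI order_trans)+
      ultimately have "B \<times> A \<subseteq> approx_rel dX MX PX dY MY PY U \<delta> R r"
        using A B by (auto simp: approx_rel_def)
      \<comment> \<open>The product \<open>B \<times> A\<close> projects onto \<open>A\<close> only
        for nonempty \<open>B\<close>; positivity of \<delta> ensures this.\<close>
      moreover have "B \<noteq> {}" using B assms by (auto simp: Y.P_empty)
      ultimately show ?thesis by force
    qed
    moreover have "snd ` approx_rel dX MX PX dY MY PY U \<delta> R r \<subseteq> X"
      using approx_rel_subset by fastforce
    ultimately show ?thesis
      using dense unfolding coarsely_dense_def by (smt (verit) Union_iff mem_Collect_eq subsetD)
  qed
  then show ?thesis using \<open>r0 \<ge> 0\<close> \<open>R0 \<ge> 0\<close> by blast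
qed

end

section \<open>Coarse maps defined by relations\<close>

lemma controlled_relD:
  assumes "controlled_rel dX dY S" "r \<ge> 0"
  shows "\<exists>R\<ge>0. \<forall>y x y' x'. (y, x) \<in> S \<longrightarrow> (y', x') \<in> S \<longrightarrow> dX x x' \<le> ennreal r \<longrightarrow>
    dY y y' \<le> ennreal R"
proof -
  obtain R where "R \<ge> 0"
    and "\<forall>(y, x)\<in>S. \<forall>(y', x')\<in>S. dX x x' \<le> ennreal r \<longrightarrow> dY y y' \<le> ennreal R"
    using assms unfolding controlled_rel_def by blast
  then show ?thesis by (intro exI[of _ R]) auto
qed

text \<open>A choice of related points, after moving \<open>x\<close> by at most \<open>K\<close>,
  inherits control from \<open>S\<close>. Graph points are within \<open>K\<close> of
  \<open>S\<close> along \<open>X\<close>, and points of \<open>S\<close> are within a control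
  constant of the graph along \<open>Y\<close>.\<close>

lemma represents_relI:
  assumes X: "extended_metric X dX" and Y: "extended_metric Y dY"
    and S: "S \<subseteq> Y \<times> X" "controlled_rel dX dY S" and "K \<ge> 0"
    and f: "\<And>x. x \<in> X \<Longrightarrow> \<exists>x'. (f x, x') \<in> S \<and> dX x x' \<le> ennreal K"
  shows "represents_rel X dX Y dY f S"
proof -
  interpret X: extended_metric X dX by fact
  interpret Y: extended_metric Y dY by fact
  have ctrl: "controlled_fun X dX dY f"
    unfolding controlled_fun_def
  proof (intro allI impI)
    fix r :: real assume "r \<ge> 0"
    obtain R where "R \<ge> 0" and R: "\<And>y x y' x'. (y, x) \<in> S \<Longrightarrow> (y', x') \<in> S \<Longrightarrow>
        dX x x' \<le> ennreal (K + r + K) \<Longrightarrow> dY y y' \<le> ennreal R"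
      using controlled_relD[OF S(2), of "K + r + K"] \<open>r \<ge> 0\<close> \<open>K \<ge> 0\<close> by auto
    have "dY (f x) (f x') \<le> ennreal R" if xx': "x \<in> X" "x' \<in> X" "dX x x' \<le> ennreal r" for x x'
    proof -
      obtain z z' where z: "(f x, z) \<in> S" "dX x z \<le> ennreal K" "(f x', z') \<in> S" "dX x' z' \<le> ennreal K"
        using f xx' by meson
      then have "dX z z' \<le> ennreal (K + r + K)"
        using xx' S(1) \<open>r \<ge> 0\<close> \<open>K \<ge> 0\<close> X.dist_sym[of z x]
        by (intro X.dist_through[of z x _ x']) auto
      then show ?thesis using R z by blast
    qed
    then show "\<exists>R\<ge>0. \<forall>x\<in>X. \<forall>x'\<in>X. dX x x' \<le> ennreal r \<longrightarrow> dY (f x) (f x') \<le> ennreal R"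
      using \<open>R \<ge> 0\<close> by blast
  qed
  obtain L where "L \<ge> 0" and L: "\<And>y x y' x'. (y, x) \<in> S \<Longrightarrow> (y', x') \<in> S \<Longrightarrow>
      dX x x' \<le> ennreal K \<Longrightarrow> dY y y' \<le> ennreal L"
    using controlled_relD[OF S(2) \<open>K \<ge> 0\<close>] by blast
  let ?d = "prod_edist dY dX" and ?G = "{(f x, x) | x. x \<in> X}"
  have "(INF t\<in>S. ?d (f x, x) t) \<le> ennreal K" if x: "x \<in> X" for x
  proof -
    obtain x' where x': "(f x, x') \<in> S" "dX x x' \<le> ennreal K" using f x by blast
    then have "dY (f x) (f x) = 0" using S(1) Y.dist_eq_0_iff[of "f x" "f x"] by auto
    then show ?thesis using x' by (intro INF_lower2[OF x'(1)]) (simp add: prod_edist_def)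
  qed
  moreover have "(INF s\<in>?G. ?d s (y, x)) \<le> ennreal L" if yx: "(y, x) \<in> S" for y x
  proof -
    have x: "x \<in> X" "y \<in> Y" using yx S(1) by auto
    obtain x' where x': "(f x, x') \<in> S" "dX x x' \<le> ennreal K" using f x by blast
    then have "dX x' x \<le> ennreal K" using X.dist_sym[of x x'] x S(1) by auto
    then have "dY (f x) y \<le> ennreal L" using L[OF x'(1) yx] by simp
    moreover have "dX x x = 0" using X.dist_eq_0_iff x by simp
    ultimately show ?thesis
      using x by (intro INF_lower2[of "(f x, x)"]) (auto simp: prod_edist_def)
  qed
  ultimately have "hausdorff_edist ?d ?G S \<le> max (ennreal K) (ennreal L)"
    unfolding hausdorff_edist_def by (intro max.mono SUP_least) auto
  also have "\<dots> < \<infinity>" by simp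
  finally have "hausdorff_edist ?d ?G S < \<infinity>" .
  moreover have "f \<in> X \<rightarrow> Y" using f S(1) by blast
  ultimately show ?thesis using ctrl by (simp add: represents_rel_def)
qed

text \<open>The point \<open>x'\<close> is related to \<open>f x\<close>, and
  \<open>f' (f x)\<close> is related to some \<open>y'\<close> near \<open>f x\<close>. Control of
  the transpose therefore places \<open>f' (f x)\<close> near \<open>x'\<close>, which is near
  \<open>x\<close>.\<close>

lemma inverse_selections_close:
  assumes X: "extended_metric X dX" and Y: "extended_metric Y dY"
    and S: "S \<subseteq> Y \<times> X" "controlled_rel dY dX (S\<inverse>)" and "K \<ge> 0" "K' \<ge> 0"
    and f: "\<And>x. x \<in> X \<Longrightarrow> \<exists>x'. (f x, x') \<in> S \<and> dX x x' \<le> ennreal K"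
    and f': "\<And>y. y \<in> Y \<Longrightarrow> \<exists>y'. (f' y, y') \<in> S\<inverse> \<and> dY y y' \<le> ennreal K'"
  shows "uniformly_close X dX (f' \<circ> f) id"
proof -
  interpret X: extended_metric X dX by fact
  obtain L where "L \<ge> 0" and L: "\<And>x y x' y'. (x, y) \<in> S\<inverse> \<Longrightarrow> (x', y') \<in> S\<inverse> \<Longrightarrow>
      dY y y' \<le> ennreal K' \<Longrightarrow> dX x x' \<le> ennreal L"
    using controlled_relD[OF S(2) \<open>K' \<ge> 0\<close>] by blast
  have "dX (f' (f x)) x \<le> ennreal (K + L)" if x: "x \<in> X" for x
  proof -
    obtain x' where x': "(f x, x') \<in> S" "dX x x' \<le> ennreal K" using f x by blast
    have in_X: "x' \<in> X" "f x \<in> Y" using x' S(1) by auto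
    obtain y' where y': "(f' (f x), y') \<in> S\<inverse>" "dY (f x) y' \<le> ennreal K'" using f' in_X by blast
    have "f' (f x) \<in> X" using y' S(1) by auto
    moreover have "dX x' (f' (f x)) \<le> ennreal L" using L[of x' "f x"] x' y' by auto
    ultimately have "dX x (f' (f x)) \<le> ennreal (K + L)"
      using x x' in_X \<open>K \<ge> 0\<close> \<open>L \<ge> 0\<close> by (intro X.dist_triangle_real[of x x']) auto
    then show ?thesis using X.dist_sym[of x "f' (f x)"] x \<open>f' (f x) \<in> X\<close> by simp
  qed
  then show ?thesis
    unfolding uniformly_close_def using \<open>K \<ge> 0\<close> \<open>L \<ge> 0\<close> by (intro exI[of _ "K + L"]) auto
qed

text \<open>Density of the two projections yields selections \<open>f\<close> and \<open>f'\<close>;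
  control of \<open>S\<close> and of its transpose makes them mutually inverse up to bounded
  distance.\<close>

lemma coarse_equivalence_converse:
  assumes X: "extended_metric X dX" and Y: "extended_metric Y dY"
    and S: "defines_coarse_map X dX Y dY S" and S': "defines_coarse_map Y dY X dX (S\<inverse>)"
  shows "coarse_equivalence_with_inverse X dX Y dY S (S\<inverse>)"
proof -
  have sub: "S \<subseteq> Y \<times> X" "S\<inverse> \<subseteq> X \<times> Y"
    and ctrl: "controlled_rel dX dY S" "controlled_rel dY dX (S\<inverse>)"
    and dense: "coarsely_dense X dX (snd ` S)" "coarsely_dense Y dY (snd ` (S\<inverse>))"
    using S S' by (auto simp: defines_coarse_map_def)
  obtain K where "K \<ge> 0" and "\<forall>x\<in>X. \<exists>z\<in>snd ` S. dX x z \<le> ennreal K"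
    using dense(1) by (auto simp: coarsely_dense_def)
  then have "\<forall>x\<in>X. \<exists>y x'. (y, x') \<in> S \<and> dX x x' \<le> ennreal K" by force
  then obtain f where f: "\<And>x. x \<in> X \<Longrightarrow> \<exists>x'. (f x, x') \<in> S \<and> dX x x' \<le> ennreal K"
    by metis
  obtain K' where "K' \<ge> 0" and "\<forall>y\<in>Y. \<exists>z\<in>snd ` (S\<inverse>). dY y z \<le> ennreal K'"
    using dense(2) unfolding coarsely_dense_def by blast
  then have "\<forall>y\<in>Y. \<exists>x y'. (x, y') \<in> S\<inverse> \<and> dY y y' \<le> ennreal K'" by force
  then obtain f' where f': "\<And>y. y \<in> Y \<Longrightarrow> \<exists>y'. (f' y, y') \<in> S\<inverse> \<and> dY y y' \<le> ennreal K'"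
    by metis
  have "represents_rel X dX Y dY f S"
    by (rule represents_relI[OF X Y sub(1) ctrl(1) \<open>K \<ge> 0\<close> f])
  moreover have "represents_rel Y dY X dX f' (S\<inverse>)"
    by (rule represents_relI[OF Y X sub(2) ctrl(2) \<open>K' \<ge> 0\<close> f'])
  moreover have "uniformly_close X dX (f' \<circ> f) id"
    by (rule inverse_selections_close[OF X Y sub(1) ctrl(2) \<open>K \<ge> 0\<close> \<open>K' \<ge> 0\<close> f f'])
  moreover have "uniformly_close Y dY (f \<circ> f') id"
    using inverse_selections_close[OF Y X sub(2) _ \<open>K' \<ge> 0\<close> \<open>K \<ge> 0\<close> f', of f] ctrl(1) f by simp
  ultimately show ?thesis
    using S S' unfolding coarse_equivalence_with_inverse_def by blast
qed

theorem theoremD: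
  fixes X :: "'x set" and dX :: "'x \<Rightarrow> 'x \<Rightarrow> ennreal" and MX :: "'x set set"
    and PX :: "'x set \<Rightarrow> ('h::complex_hilbert \<Rightarrow>\<^sub>L 'h)"
    and Y :: "'y set" and dY :: "'y \<Rightarrow> 'y \<Rightarrow> ennreal" and MY :: "'y set set"
    and PY :: "'y set \<Rightarrow> ('k::complex_hilbert \<Rightarrow>\<^sub>L 'k)"
    and U :: "'h \<Rightarrow>\<^sub>L 'k"
  assumes "discrete_module X dX MX PX" and "faithful_module X dX MX PX"
    and "discrete_module Y dY MY PY" and "faithful_module Y dY MY PY"
    and "unitary_op U"
    and "quasi_controlled dX MX PX dY MY PY (Ad U)"
    and "quasi_controlled dY MY PY dX MX PX (Ad (cadjoint U))"
  shows "\<forall>\<delta>::real. 0 < \<delta> \<and> \<delta> < 1 \<longrightarrow>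
    (\<exists>r\<^sub>0\<ge>0. \<exists>R\<^sub>0\<ge>0. \<forall>r\<ge>r\<^sub>0. \<forall>R\<ge>R\<^sub>0.
      coarse_equivalence_with_inverse X dX Y dY
        (approx_rel dX MX PX dY MY PY U \<delta> R r)
        (approx_rel dY MY PY dX MX PX (cadjoint U) \<delta> r R))"
proof (intro allI impI)
  fix \<delta> :: real assume "0 < \<delta> \<and> \<delta> < 1"
  then have \<delta>: "0 < \<delta>" "\<delta> < 1" by auto
  interpret XY: quasi_controlled_unitary X dX MX PX Y dY MY PY U
    using assms by (intro quasi_controlled_unitary.intro quasi_controlled_unitary_axioms.intro)
  interpret YX: quasi_controlled_unitary Y dY MY PY X dX MX PX "cadjoint U"
    by (rule XY.flip)
  obtain r1 R1 where 1: "r1 \<ge> 0" "R1 \<ge> 0" "\<And>r R. r \<ge> r1 \<Longrightarrow> R \<ge> R1 \<Longrightarrow>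
      coarsely_dense X dX (snd ` approx_rel dX MX PX dY MY PY U \<delta> R r)"
    using XY.approx_rel_dense[OF assms(2) \<delta>] by metis
  \<comment> \<open>For the adjoint the source is \<open>Y\<close>, so \<open>R\<close> and
    \<open>r\<close> exchange their roles.\<close>
  obtain R2 r2 where 2: "R2 \<ge> 0" "r2 \<ge> 0" "\<And>R r. R \<ge> R2 \<Longrightarrow> r \<ge> r2 \<Longrightarrow>
      coarsely_dense Y dY (snd ` approx_rel dY MY PY dX MX PX (cadjoint U) \<delta> r R)"
    using YX.approx_rel_dense[OF assms(4) \<delta>] by metis
  have "coarse_equivalence_with_inverse X dX Y dY
        (approx_rel dX MX PX dY MY PY U \<delta> R r)
        (approx_rel dY MY PY dX MX PX (cadjoint U) \<delta> r R)"
    if rR: "r \<ge> max r1 r2" "R \<ge> max R1 R2" for r R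
  proof -
    have nonneg: "r \<ge> 0" "R \<ge> 0" using 1 rR by auto
    have "defines_coarse_map X dX Y dY (approx_rel dX MX PX dY MY PY U \<delta> R r)"
      using 1 rR XY.approx_rel_subset XY.approx_rel_controlled[OF nonneg \<delta>(1)]
      by (simp add: defines_coarse_map_def)
    moreover have "defines_coarse_map Y dY X dX (approx_rel dY MY PY dX MX PX (cadjoint U) \<delta> r R)"
      using 2 rR YX.approx_rel_subset YX.approx_rel_controlled[OF nonneg(2,1) \<delta>(1)]
      by (simp add: defines_coarse_map_def)
    ultimately show ?thesis
      unfolding XY.approx_rel_cadjoint
      by (intro coarse_equivalence_converse XY.X.extended_metric_axioms XY.Y.extended_metric_axioms)
  qed
  moreover have "max r1 r2 \<ge> 0" "max R1 R2 \<ge> 0" using 1 2 by auto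
  ultimately show "\<exists>r\<^sub>0\<ge>0. \<exists>R\<^sub>0\<ge>0. \<forall>r\<ge>r\<^sub>0. \<forall>R\<ge>R\<^sub>0.
      coarse_equivalence_with_inverse X dX Y dY
        (approx_rel dX MX PX dY MY PY U \<delta> R r)
        (approx_rel dY MY PY dX MX PX (cadjoint U) \<delta> r R)"
    by blast
qed

end
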